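(* Fix constants $k,\rho,c,\lambda,\Theta_\infty>0$ (hence $\alpha=\frac{k}{\rho c}$ and $\mathrm{Ste}=\frac{c\Theta_\infty}{\lambda}>0$). For $h>0$ let $\mathrm{Bi}=\frac{h\sqrt{\alpha}}{k}$ and let $(T_1,s_1)$, depending on $\mathrm{Bi}$, be the quadratic-profile solution of Problem (P1); let $(T_{1\infty},s_{1\infty})$ be the quadratic-profile solution of Problem (P1$_\infty$). Then the solution of (P1) converges to the solution of (P1$_\infty$) as $\mathrm{Bi}\to\infty$, that is, $$T_1(x,t)\to T_{1\infty}(x,t)\quad\text{and}\quad s_1(t)\to s_{1\infty}(t)\quad\text{when }\mathrm{Bi}\to\infty,$$ for every $t>0$ and $0<x<s_{1\infty}(t)$.
   Context: Problem (P1): find $s_1(t)$ and $T_1(x,t)$, $0\le x\le s_1(t)$, $t>0$, such that for all $t>0$: $\frac{d}{dt}\int_{0}^{s_{1}(t)}T_{1}(x,t)\,dx=\frac{k}{\rho c}\left[\frac{\rho\lambda}{k}\dot{s}_{1}(t)-\frac{\partial T_1}{\partial x}(0,t)\right]$; $k\frac{\partial T_1}{\partial x}(0,t)=\frac{h}{\sqrt{t}}(T_{1}(0,t)+\Theta_{\infty})$; $T_{1}(s_{1}(t),t)=0$; $\left(\frac{\partial T_1}{\partial x}(s_{1}(t),t)\right)^2=-\frac{\lambda}{c}\frac{\partial^2T_1}{\partial x^2}(s_{1}(t),t)$; and $s_{1}(0)=0$. Problem (P1$_\infty$) is the same problem for $(T_{1\infty},s_{1\infty})$ with the second condition (the convective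 one) replaced by $T_{1\infty}(0,t)=-\Theta_\infty$, $t>0$. A quadratic-profile solution of either problem is one of the form $T(x,t)=-A\Theta_\infty\left(1-\frac{x}{s(t)}\right)-B\Theta_\infty\left(1-\frac{x}{s(t)}\right)^2$ with constants $A>0$, $B>0$. Each problem has exactly one such solution, and explicitly: (P1): $s_1(t)=2\xi_1\sqrt{\alpha t}$, $A=A_1=\frac{6\mathrm{Ste}-(6+2\mathrm{Ste})\xi_{1}^{2}-\frac{6}{\mathrm{Bi}}\xi_{1}}{\mathrm{Ste}(\xi_{1}^{2}+\frac{2}{\mathrm{Bi}}\xi_{1}+3)}$, $B=B_1=\frac{(3\mathrm{Ste}+6)\xi_{1}^{2}+\frac{3}{\mathrm{Bi}}\xi_{1}-3\mathrm{Ste}}{\mathrm{Ste}(\xi_{1}^{2}+\frac{2}{\mathrm{Bi}}\xi_{1}+3)}$, where $\xi_1$ is the unique solution in $(\xi^{\min},\xi^{\max})$ of $$(12+9\mathrm{Ste}+2\mathrm{Ste}^{2})z^{4}+\tfrac{21+6\mathrm{Ste}}{\mathrm{Bi}}z^{3}+\left(\tfrac{12}{\mathrm{Bi}^{2}}-42\mathrm{Ste}-12\mathrm{Ste}^{2}-18\right)z^{2}-\tfrac{30\mathrm{Ste}+9}{\mathrm{Bi}}z+9\mathrm{Ste}(1+2\mathrm{Ste})=0,$$ with $\xi^{\min}=\frac{\sqrt{4\mathrm{Ste}^2+8\mathrm{Ste}+1/\mathrm{Bi}^2}-1/\mathrm{Bi}}{2(2+\mathrm{Ste})}$ and $\xi^{\max}=\frac{\sqrt{12\mathrm{Ste}^2+36\mathrm{Ste}+9/\mathrm{Bi}^2}-3/\mathrm{Bi}}{2(3+\mathrm{Ste})}$.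 (P1$_\infty$): $s_{1\infty}(t)=2\xi_{1\infty}\sqrt{\alpha t}$, $A=A_{1\infty}=\frac{\sqrt{2\mathrm{Ste}+1}-1}{\mathrm{Ste}}$, $B=B_{1\infty}=1+\frac{1-\sqrt{2\mathrm{Ste}+1}}{\mathrm{Ste}}$, $\xi_{1\infty}=\left(\frac{3(2\mathrm{Ste}+1)(\mathrm{Ste}+3)-(9+6\mathrm{Ste})\sqrt{2\mathrm{Ste}+1}}{12+9\mathrm{Ste}+2\mathrm{Ste}^2}\right)^{1/2}$. *)

theory Defs
  imports "HOL-Analysis.Analysis"
begin

definition diffusivity :: "real \<Rightarrow> real \<Rightarrow> real \<Rightarrow> real"
  where "diffusivity k \<rho> c = k / (\<rho> * c)"

definition biot :: "real \<Rightarrow> real \<Rightarrow> real \<Rightarrow> real \<Rightarrow> real"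
  where "biot k \<rho> c h = h * sqrt (diffusivity k \<rho> c) / k"

text \<open>
  The conditions shared by the problems with convective and with temperature boundary condition.
  The temperature T x t only has meaning for t > 0 and 0 \<le> x \<le> s t, so the space derivatives are
  taken relative to the interval {0..s t} (one-sided at its end points) and nothing is required
  outside of it. Tx, Txx and s' are the derivatives of T and s; on the domain they are determined by
  T and s. Continuity of s on {0..} ties the initial condition s 0 = 0 to the values for t > 0.
\<close>
definition stefan_conditions ::
  "real \<Rightarrow> real \<Rightarrow> real \<Rightarrow> real \<Rightarrow> (real \<Rightarrow> real \<Rightarrow> real) \<Rightarrow> (real \<Rightarrow> real) \<Rightarrow>
   (real \<Rightarrow> real \<Rightarrow> real) \<Rightarrow> (real \<Rightarrow> real \<Rightarrow> real) \<Rightarrow> (real \<Rightarrow> real) \<Rightarrow> bool"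
  where "stefan_conditions k \<rho> c lam T s Tx Txx s' \<longleftrightarrow>
    s 0 = 0 \<and> continuous_on {0..} s \<and>
    (\<forall>t>0.
      s t > 0 \<and>
      (s has_real_derivative s' t) (at t) \<and>
      (\<forall>x\<in>{0..s t}. ((\<lambda>y. T y t) has_real_derivative Tx x t) (at x within {0..s t})) \<and>
      (\<forall>x\<in>{0..s t}. ((\<lambda>y. Tx y t) has_real_derivative Txx x t) (at x within {0..s t})) \<and>
      ((\<lambda>\<tau>. integral {0..s \<tau>} (\<lambda>x. T x \<tau>)) has_real_derivative
         k / (\<rho> * c) * (\<rho> * lam / k * s' t - Tx 0 t)) (at t) \<and>
      T (s t) t = 0 \<and>
      (Tx (s t) t)\<^sup>2 = - (lam / c) * Txx (s t) t)"

definition solves_P1 ::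
  "real \<Rightarrow> real \<Rightarrow> real \<Rightarrow> real \<Rightarrow> real \<Rightarrow> real \<Rightarrow> (real \<Rightarrow> real \<Rightarrow> real) \<Rightarrow> (real \<Rightarrow> real) \<Rightarrow> bool"
  where "solves_P1 k \<rho> c lam \<Theta> h T s \<longleftrightarrow>
    (\<exists>Tx Txx s'. stefan_conditions k \<rho> c lam T s Tx Txx s' \<and>
       (\<forall>t>0. k * Tx 0 t = h / sqrt t * (T 0 t + \<Theta>)))"

definition solves_P1_inf ::
  "real \<Rightarrow> real \<Rightarrow> real \<Rightarrow> real \<Rightarrow> real \<Rightarrow> (real \<Rightarrow> real \<Rightarrow> real) \<Rightarrow> (real \<Rightarrow> real) \<Rightarrow> bool"
  where "solves_P1_inf k \<rho> c lam \<Theta> T s \<longleftrightarrow>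
    (\<exists>Tx Txx s'. stefan_conditions k \<rho> c lam T s Tx Txx s') \<and> (\<forall>t>0. T 0 t = - \<Theta>)"

definition quadratic_profile :: "real \<Rightarrow> (real \<Rightarrow> real \<Rightarrow> real) \<Rightarrow> (real \<Rightarrow> real) \<Rightarrow> bool"
  where "quadratic_profile \<Theta> T s \<longleftrightarrow>
    (\<exists>A>0. \<exists>B>0. \<forall>t>0. \<forall>x\<in>{0..s t}.
       T x t = - A * \<Theta> * (1 - x / s t) - B * \<Theta> * (1 - x / s t)\<^sup>2)"

end

theory Submission
  imports Defs
begin

text \<open>
  Inserting a quadratic profile into the Stefan conditions leaves one free parameter
  \<open>a = Ste A\<close>: the second-order condition at the front forces \<open>2 Ste B = a\<^sup>2\<close>, and the integral
  balance becomes an equation for the derivative of \<open>s\<^sup>2\<close>, so that \<open>s t = 2 \<xi> sqrt (\<alpha> t)\<close> with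
  \<open>\<xi>\<^sup>2 = 3 (a + a\<^sup>2) / (6 + 3 a + a\<^sup>2)\<close>. The boundary condition then fixes \<open>a\<close>: the temperature
  condition says \<open>a + a\<^sup>2 / 2 = Ste\<close>, while the convective one says
  \<open>Ste - (a + a\<^sup>2 / 2) = (a + a\<^sup>2) / (2 Bi \<xi>)\<close>. Since \<open>a\<close> and hence
  \<open>(a + a\<^sup>2) / \<xi> = \<xi> (6 + 3 a + a\<^sup>2) / 3\<close> stay bounded, the last right-hand side is
  \<open>O(1 / Bi)\<close>, so \<open>a\<close> converges to its value for the temperature condition, and \<open>s\<close> and \<open>T\<close>
  depend continuously on \<open>a\<close>.
\<close>

text \<open>The square of the front coefficient \<open>\<xi>\<close> in
  \<open>s t = 2 * \<xi> * sqrt (\<alpha> * t)\<close>. Keeping the square makes it rational in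
  \<open>a\<close>, with a denominator that never vanishes.\<close>

definition front_coeff_sq :: "real \<Rightarrow> real"
  where "front_coeff_sq a = 3 * (a + a\<^sup>2) / (6 + 3 * a + a\<^sup>2)"

lemma front_coeff_sq_denom_pos: "0 < 6 + 3 * a + (a::real)\<^sup>2"
proof -
  have "6 + 3 * a + a\<^sup>2 = (a + 3 / 2)\<^sup>2 + 15 / 4"
    by (simp add: power2_eq_square algebra_simps)
  then show ?thesis
    by (simp add: add_nonneg_pos)
qed

lemma front_coeff_sq_pos: "0 < a \<Longrightarrow> 0 < front_coeff_sq a"
  unfolding front_coeff_sq_def by (simp add: add_pos_pos)

lemma isCont_front_coeff_sq: "isCont front_coeff_sq a"
  using front_coeff_sq_denom_pos[of a]
  unfolding front_coeff_sq_def[abs_def] by (intro continuous_intros) auto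

lemma integral_quadratic_profile:
  fixes p q s :: real
  assumes "s > 0"
  shows "integral {0..s} (\<lambda>x. - p * (1 - x / s) - q * (1 - x / s)\<^sup>2) = - s * (p / 2 + q / 3)"
proof -
  let ?F = "\<lambda>x. p * s / 2 * (1 - x / s)\<^sup>2 + q * s / 3 * (1 - x / s) ^ 3"
  have "((\<lambda>x. - p * (1 - x / s) - q * (1 - x / s)\<^sup>2) has_integral (?F s - ?F 0)) {0..s}"
    using assms
    by (intro fundamental_theorem_of_calculus)
       (auto simp flip: has_real_derivative_iff_has_vector_derivative
             intro!: derivative_eq_intros simp: divide_simps, algebra)
  then have "integral {0..s} (\<lambda>x. - p * (1 - x / s) - q * (1 - x / s)\<^sup>2) = ?F s - ?F 0"
    by (rule integral_unique)
  also have "\<dots> = - s * (p / 2 + q / 3)"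
    using assms by (simp add: field_simps)
  finally show ?thesis .
qed

text \<open>Since \<open>2 * s * s'\<close> is the derivative of the square of \<open>s\<close>, the
  difference \<open>?f\<close> has derivative zero for positive times, and continuity at 0 carries
  the initial value over. Nothing is divided by \<open>s\<close>, which vanishes at 0.\<close>

lemma square_linear_of_ode:
  fixes s s' :: "real \<Rightarrow> real"
  assumes s0: "s 0 = 0" and cont: "continuous_on {0..} s"
    and deriv: "\<And>t. t > 0 \<Longrightarrow> (s has_real_derivative s' t) (at t)"
    and ode: "\<And>t. t > 0 \<Longrightarrow> 2 * s t * s' t = m"
    and t: "t > 0"
  shows "(s t)\<^sup>2 = m * t"
proof -
  let ?f = "\<lambda>\<tau>. (s \<tau>)\<^sup>2 - m * \<tau>"
  have "?f t = ?f 0"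
  proof (rule DERIV_isconst_end[OF t])
    show "continuous_on {0..t} ?f"
      by (intro continuous_intros continuous_on_subset[OF cont]) auto
    show "DERIV ?f \<tau> :> 0" if "0 < \<tau>" for \<tau>
      using ode[OF that]
      by (auto intro!: derivative_eq_intros deriv[OF that] simp: mult_ac)
  qed
  then show ?thesis
    using s0 by simp
qed

text \<open>Only the conditions common to both problems enter, so the lemma applies to each of them.
  What remains is the single parameter \<open>a\<close>, to be fixed by the condition at
  \<open>x = 0\<close>; the formula for \<open>Tx 0 t\<close> is exported for the convective
  one.\<close>

lemma stefan_quadratic_profile:
  assumes pos: "k > 0" "\<rho> > 0" "c > 0" "lam > 0" "\<Theta> > 0"
    and stefan: "stefan_conditions k \<rho> c lam T s Tx Txx s'"
    and quad: "quadratic_profile \<Theta> T s"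
  obtains a where "a > 0"
    and "\<And>t. t > 0 \<Longrightarrow> s t = 2 * sqrt (diffusivity k \<rho> c * t * front_coeff_sq a)"
    and "\<And>t x. t > 0 \<Longrightarrow> x \<in> {0..s t} \<Longrightarrow>
           T x t = - (lam / c) * (a * (1 - x / s t) + a\<^sup>2 / 2 * (1 - x / s t)\<^sup>2)"
    and "\<And>t. t > 0 \<Longrightarrow> Tx 0 t = lam / c * (a + a\<^sup>2) / s t"
proof -
  note st = stefan[unfolded stefan_conditions_def]
  obtain A B where AB: "A > 0" "B > 0"
    and T: "\<And>t x. t > 0 \<Longrightarrow> x \<in> {0..s t} \<Longrightarrow>
              T x t = - (A * \<Theta>) * (1 - x / s t) - (B * \<Theta>) * (1 - x / s t)\<^sup>2"
    using quad unfolding quadratic_profile_def by auto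
  define p where "p = A * \<Theta>"
  define q where "q = B * \<Theta>"
  define r where "r = lam / c"
  \<comment> \<open>Measuring temperature in units of \<open>lam / c\<close> removes the physical
    constants from the front condition.\<close>
  define a where "a = p / r"
  have r: "r > 0" and p: "p > 0" and a: "a > 0"
    using pos AB by (auto simp: r_def p_def a_def)
  have pa: "p = r * a"
    using r by (simp add: a_def)
  have s_pos: "s t > 0" if "t > 0" for t
    using st that by blast
  \<comment> \<open>The profile is known only on \<open>{0..s t}\<close>, so derivatives are
    compared within that interval. They are unique there because \<open>s t > 0\<close> makes each
    of its points a limit point.\<close>
  have Tx: "Tx x t = p / s t + 2 * q * (1 - x / s t) / s t" if t: "t > 0" and x: "x \<in> {0..s t}" for t x
  proof (rule has_field_derivative_unique)
    show "((\<lambda>y. T y t) has_real_derivative Tx x t) (at x within {0..s t})"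
      using st t x by blast
    have "((\<lambda>y. - p * (1 - y / s t) - q * (1 - y / s t)\<^sup>2) has_real_derivative
            p / s t + 2 * q * (1 - x / s t) / s t) (at x within {0..s t})"
      using s_pos[OF t] by (auto intro!: derivative_eq_intros simp: divide_simps) algebra
    then show "((\<lambda>y. T y t) has_real_derivative p / s t + 2 * q * (1 - x / s t) / s t)
        (at x within {0..s t})"
      by (rule has_field_derivative_transform_within[OF _ zero_less_one x])
         (use T t in \<open>auto simp: p_def q_def\<close>)
    show "at x within {0..s t} \<noteq> bot"
      using x s_pos[OF t] by (simp add: trivial_limit_within islimpt_Icc)
  qed
  have Txx: "Txx (s t) t = - 2 * q / (s t)\<^sup>2" if t: "t > 0" for t
  proof (rule has_field_derivative_unique)
    have x: "s t \<in> {0..s t}"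
      using s_pos[OF t] by simp
    show "((\<lambda>y. Tx y t) has_real_derivative Txx (s t) t) (at (s t) within {0..s t})"
      using st t x by blast
    have "((\<lambda>y. p / s t + 2 * q * (1 - y / s t) / s t) has_real_derivative
            - 2 * q / (s t)\<^sup>2) (at (s t) within {0..s t})"
      using s_pos[OF t] by (auto intro!: derivative_eq_intros simp: field_simps power2_eq_square)
    then show "((\<lambda>y. Tx y t) has_real_derivative - 2 * q / (s t)\<^sup>2) (at (s t) within {0..s t})"
      by (rule has_field_derivative_transform_within[OF _ zero_less_one x]) (use Tx t in auto)
    show "at (s t) within {0..s t} \<noteq> bot"
      using s_pos[OF t] by (simp add: trivial_limit_within islimpt_Icc)
  qed
  have qa: "q = r * a\<^sup>2 / 2"
  proof -
    \<comment> \<open>One time is enough: both sides scale like the inverse square of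
      \<open>s t\<close>, which cancels and leaves a relation between \<open>p\<close> and
      \<open>q\<close>.\<close>
    have "(Tx (s 1) 1)\<^sup>2 = - r * Txx (s 1) 1"
      using st by (simp add: r_def)
    then have "p\<^sup>2 = 2 * r * q"
      using Tx[of 1 "s 1"] Txx[of 1] s_pos[of 1] by (simp add: power_divide)
    then show ?thesis
      using r by (simp add: pa power2_eq_square mult_ac)
  qed
  have Tx0: "Tx 0 t = r * (a + a\<^sup>2) / s t" if "t > 0" for t
    using Tx[OF that, of 0] s_pos[OF that] by (simp add: pa qa field_simps)
  define \<alpha> where "\<alpha> = diffusivity k \<rho> c"
  have \<alpha>: "\<alpha> > 0"
    using pos by (simp add: \<alpha>_def diffusivity_def)
  have ode: "2 * s t * s' t = 4 * \<alpha> * front_coeff_sq a" if t: "t > 0" for t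
  proof -
    have ds: "(s has_real_derivative s' t) (at t)"
      using st t by blast
    have "((\<lambda>\<tau>. integral {0..s \<tau>} (\<lambda>x. T x \<tau>)) has_real_derivative
         k / (\<rho> * c) * (\<rho> * lam / k * s' t - Tx 0 t)) (at t)"
      using st t by blast
    \<comment> \<open>The integral has the closed form \<open>- s \<tau> * (p / 2 + q / 3)\<close>
      at all positive times, hence near \<open>t\<close>; its derivative must agree with the one
      demanded by the heat balance.\<close>
    moreover have "((\<lambda>\<tau>. integral {0..s \<tau>} (\<lambda>x. T x \<tau>)) has_real_derivative
         - s' t * (p / 2 + q / 3)) (at t)"
    proof (rule has_field_derivative_transform_within_open)
      show "((\<lambda>\<tau>. - s \<tau> * (p / 2 + q / 3)) has_real_derivative - s' t * (p / 2 + q / 3)) (at t)"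
        by (auto intro!: derivative_eq_intros ds)
      show "open {0::real<..}" "t \<in> {0<..}"
        using t by auto
      fix \<tau> :: real
      assume "\<tau> \<in> {0<..}"
      then have \<tau>: "\<tau> > 0" by simp
      have "integral {0..s \<tau>} (\<lambda>x. T x \<tau>) =
            integral {0..s \<tau>} (\<lambda>x. - p * (1 - x / s \<tau>) - q * (1 - x / s \<tau>)\<^sup>2)"
        by (rule Henstock_Kurzweil_Integration.integral_cong) (simp add: T[OF \<tau>] p_def q_def)
      then show "- s \<tau> * (p / 2 + q / 3) = integral {0..s \<tau>} (\<lambda>x. T x \<tau>)"
        by (simp only: integral_quadratic_profile[OF s_pos[OF \<tau>]])
    qed
    ultimately have "k / (\<rho> * c) * (\<rho> * lam / k * s' t - Tx 0 t) = - s' t * (p / 2 + q / 3)"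
      by (rule DERIV_unique)
    moreover have "k / (\<rho> * c) * (\<rho> * lam / k * s' t - Tx 0 t) = r * s' t - \<alpha> * Tx 0 t"
      using pos by (simp add: \<alpha>_def diffusivity_def r_def field_simps)
    ultimately have "r * s' t + s' t * (p / 2 + q / 3) = \<alpha> * (r * (a + a\<^sup>2) / s t)"
      by (simp add: Tx0[OF t])
    \<comment> \<open>Multiplication by \<open>6 * s t\<close>: the factor of
      \<open>r * s' t\<close> is \<open>1 + a / 2 + a\<^sup>2 / 6\<close>, the source of the
      denominator in \<open>front_coeff_sq\<close>.\<close>
    then have "r * (s t * s' t * (6 + 3 * a + a\<^sup>2)) = r * (6 * \<alpha> * (a + a\<^sup>2))"
      using s_pos[OF t] by (simp add: pa qa field_simps)
    then have "s t * s' t * (6 + 3 * a + a\<^sup>2) = 6 * \<alpha> * (a + a\<^sup>2)"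
      using r by simp
    then show ?thesis
      using front_coeff_sq_denom_pos[of a] unfolding front_coeff_sq_def
      by (simp add: field_simps)
  qed
  have s: "s t = 2 * sqrt (\<alpha> * t * front_coeff_sq a)" if t: "t > 0" for t
  proof -
    have "(s t)\<^sup>2 = 4 * \<alpha> * front_coeff_sq a * t"
      using st by (intro square_linear_of_ode[OF _ _ _ ode t]) blast+
    then have "s t = sqrt (4 * (\<alpha> * t * front_coeff_sq a))"
      using s_pos[OF t] by (intro real_sqrt_unique[symmetric]) (auto simp: mult_ac)
    then show ?thesis
      by (simp add: real_sqrt_mult)
  qed
  show thesis
  proof (rule that[OF a])
    show "T x t = - (lam / c) * (a * (1 - x / s t) + a\<^sup>2 / 2 * (1 - x / s t)\<^sup>2)"
      if "t > 0" "x \<in> {0..s t}" for t x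
      unfolding T[OF that] p_def[symmetric] q_def[symmetric] r_def[symmetric] pa qa
      by (simp add: algebra_simps)
  qed (use s Tx0 in \<open>auto simp: \<alpha>_def r_def\<close>)
qed

text \<open>The definition of \<open>front_coeff_sq\<close> eliminates \<open>a + a\<^sup>2\<close>
  from the hypothesis, and one factor \<open>E\<close> cancels. The result \<open>key\<close> has a
  positive right-hand side, so \<open>w < S\<close>; this a priori bound on \<open>a\<close> in turn
  bounds that right-hand side independently of \<open>Bi\<close>.\<close>

lemma convective_deficit_bound:
  fixes a S Bi :: real
  assumes a: "a > 0" and Bi: "Bi > 0"
    and eq: "a + a\<^sup>2 = 2 * Bi * sqrt (front_coeff_sq a) * (S - (a + a\<^sup>2 / 2))"
  shows "\<bar>(a + a\<^sup>2 / 2) - S\<bar> \<le> (2 + S) / Bi"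
proof -
  define w where "w = a + a\<^sup>2 / 2"
  define E where "E = sqrt (front_coeff_sq a)"
  have E: "E > 0"
    using front_coeff_sq_pos[OF a] by (simp add: E_def)
  have E2: "E\<^sup>2 = front_coeff_sq a"
    using front_coeff_sq_pos[OF a] by (simp add: E_def)
  then have *: "E\<^sup>2 * (6 + 3 * a + a\<^sup>2) = 3 * (a + a\<^sup>2)"
    using front_coeff_sq_denom_pos[of a] by (simp add: front_coeff_sq_def)
  have "E\<^sup>2 \<le> 2\<^sup>2"
    unfolding E2 front_coeff_sq_def using front_coeff_sq_denom_pos[of a] a
    by (simp add: divide_le_eq)
  then have E_le: "E \<le> 2"
    by (rule power2_le_imp_le) simp
  have "a + a\<^sup>2 = 2 * Bi * E * (S - w)"
    using eq by (simp only: E_def w_def)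
  with * have "E * (E * (6 + 3 * a + a\<^sup>2)) = E * (6 * Bi * (S - w))"
    by algebra
  then have key: "6 * Bi * (S - w) = E * (6 + 3 * a + a\<^sup>2)"
    using E by simp
  then have "0 < 6 * Bi * (S - w)"
    using E a by (simp add: add_pos_pos)
  then have w: "w < S"
    using Bi by (simp add: zero_less_mult_iff)
  have "6 * Bi * (S - w) \<le> 2 * (6 + 3 * w)"
    unfolding key by (rule mult_mono) (use E_le a in \<open>auto simp: w_def\<close>)
  then have "Bi * (S - w) \<le> 2 + S"
    using w by simp
  then show ?thesis
    using w Bi by (simp add: field_simps w_def)
qed

text \<open>Expresses \<open>a\<close> as a continuous function of \<open>a + a\<^sup>2 / 2\<close>,
  so that convergence of the latter passes to \<open>a\<close>.\<close>

lemma pos_root_quadratic: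
  fixes a :: real
  assumes "a > 0"
  shows "a = sqrt (1 + 2 * (a + a\<^sup>2 / 2)) - 1"
proof -
  have "1 + 2 * (a + a\<^sup>2 / 2) = (a + 1)\<^sup>2"
    by (simp add: power2_eq_square algebra_simps)
  then show ?thesis
    using assms by simp
qed

theorem theorem4p2:
  fixes k \<rho> c lam \<Theta> :: real
    and T1 :: "real \<Rightarrow> real \<Rightarrow> real \<Rightarrow> real" and s1 :: "real \<Rightarrow> real \<Rightarrow> real"
    and T1_inf :: "real \<Rightarrow> real \<Rightarrow> real" and s1_inf :: "real \<Rightarrow> real"
  assumes "k > 0" and "\<rho> > 0" and "c > 0" and "lam > 0" and "\<Theta> > 0"
    and "\<And>h Bi. h > 0 \<Longrightarrow> Bi = biot k \<rho> c h \<Longrightarrow>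
           solves_P1 k \<rho> c lam \<Theta> h (T1 Bi) (s1 Bi) \<and> quadratic_profile \<Theta> (T1 Bi) (s1 Bi)"
    and "solves_P1_inf k \<rho> c lam \<Theta> T1_inf s1_inf" and "quadratic_profile \<Theta> T1_inf s1_inf"
  shows "\<forall>t>0. \<forall>x. 0 < x \<and> x < s1_inf t \<longrightarrow>
           ((\<lambda>Bi. T1 Bi x t) \<longlongrightarrow> T1_inf x t) at_top \<and>
           ((\<lambda>Bi. s1 Bi t) \<longlongrightarrow> s1_inf t) at_top"
proof (intro allI impI)
  note pos = assms(1-5)
  define \<alpha> where "\<alpha> = diffusivity k \<rho> c"
  \<comment> \<open>The Stefan number.\<close>
  define S where "S = \<Theta> / (lam / c)"
  define s_of where "s_of a t = 2 * sqrt (\<alpha> * t * front_coeff_sq a)" for a t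
  define T_of where "T_of a y = - (lam / c) * (a * y + a\<^sup>2 / 2 * y\<^sup>2)" for a y :: real
  have \<alpha>: "\<alpha> > 0"
    using pos by (simp add: \<alpha>_def diffusivity_def)
  have s_of_pos: "s_of a t > 0" if "a > 0" "t > 0" for a t
    using that \<alpha> front_coeff_sq_pos by (simp add: s_of_def)
  obtain b where b: "b > 0"
    and s_inf: "\<And>t. t > 0 \<Longrightarrow> s1_inf t = s_of b t"
    and T_inf: "\<And>t x. t > 0 \<Longrightarrow> x \<in> {0..s1_inf t} \<Longrightarrow> T1_inf x t = T_of b (1 - x / s1_inf t)"
  proof -
    obtain Tx Txx s' where "stefan_conditions k \<rho> c lam T1_inf s1_inf Tx Txx s'"
      using assms(7) unfolding solves_P1_inf_def by blast
    from stefan_quadratic_profile[OF pos this assms(8)] show thesis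
      unfolding \<alpha>_def[symmetric] s_of_def[symmetric] T_of_def[symmetric] using that by metis
  qed
  have bS: "b + b\<^sup>2 / 2 = S"
  proof -
    have "T1_inf 0 1 = - \<Theta>"
      using assms(7) unfolding solves_P1_inf_def by simp
    moreover have "T1_inf 0 1 = T_of b 1"
      using T_inf[of 1 0] s_inf[of 1] s_of_pos[OF b, of 1] by simp
    ultimately show ?thesis
      using pos by (simp add: T_of_def S_def field_simps)
  qed
  have "\<exists>a. a > 0 \<and> \<bar>(a + a\<^sup>2 / 2) - S\<bar> \<le> (2 + S) / Bi \<and>
     (\<forall>t>0. s1 Bi t = s_of a t) \<and>
     (\<forall>t>0. \<forall>x\<in>{0..s1 Bi t}. T1 Bi x t = T_of a (1 - x / s1 Bi t))" if Bi: "Bi > 0" for Bi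
  proof -
    \<comment> \<open>The inverse of \<open>biot\<close> in its last argument: the hypothesis ranges
      over \<open>h\<close>, whereas the limit needs every positive \<open>Bi\<close>.\<close>
    define h where "h = Bi * k / sqrt \<alpha>"
    have h: "h > 0" "Bi = biot k \<rho> c h"
      using Bi \<alpha> pos by (auto simp: h_def biot_def \<alpha>_def[symmetric])
    from assms(6)[OF this] obtain Tx Txx s'
      where st: "stefan_conditions k \<rho> c lam (T1 Bi) (s1 Bi) Tx Txx s'"
        and conv: "\<forall>t>0. k * Tx 0 t = h / sqrt t * (T1 Bi 0 t + \<Theta>)"
        and quad: "quadratic_profile \<Theta> (T1 Bi) (s1 Bi)"
      unfolding solves_P1_def by blast
    obtain a where a: "a > 0" and s: "\<And>t. t > 0 \<Longrightarrow> s1 Bi t = s_of a t"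
      and T: "\<And>t x. t > 0 \<Longrightarrow> x \<in> {0..s1 Bi t} \<Longrightarrow> T1 Bi x t = T_of a (1 - x / s1 Bi t)"
      and Tx: "\<And>t. t > 0 \<Longrightarrow> Tx 0 t = lam / c * (a + a\<^sup>2) / s1 Bi t"
      using stefan_quadratic_profile[OF pos st quad]
      unfolding \<alpha>_def[symmetric] s_of_def[symmetric] T_of_def[symmetric] by metis
    define E where "E = sqrt (front_coeff_sq a)"
    have E: "E > 0"
      using front_coeff_sq_pos[OF a] by (simp add: E_def)
    have s_1: "s1 Bi 1 = 2 * sqrt \<alpha> * E"
      using s[of 1] by (simp add: s_of_def real_sqrt_mult E_def)
    define r where "r = lam / c"
    have r: "r > 0" and \<Theta>: "\<Theta> = r * S"
      using pos by (auto simp: r_def S_def)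
    have "T1 Bi 0 1 = T_of a 1"
      using T[of 1 0] s[of 1] s_of_pos[OF a, of 1] by simp
    then have "T1 Bi 0 1 + \<Theta> = r * (S - (a + a\<^sup>2 / 2))"
      by (simp add: T_of_def r_def[symmetric] \<Theta> algebra_simps)
    \<comment> \<open>At time 1 the factor \<open>sqrt t\<close> disappears. Since
      \<open>s1 Bi t\<close> is proportional to \<open>sqrt t\<close>, other times would give the
      same equation for \<open>a\<close>.\<close>
    moreover have "k * Tx 0 1 = h * (T1 Bi 0 1 + \<Theta>)"
      using conv by simp
    ultimately have "k * r * (a + a\<^sup>2) / (2 * sqrt \<alpha> * E) = Bi * k / sqrt \<alpha> * r * (S - (a + a\<^sup>2 / 2))"
      by (simp add: Tx s_1 h_def r_def)
    then have "k * r * (a + a\<^sup>2) = k * r * (2 * Bi * E * (S - (a + a\<^sup>2 / 2)))"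
      using E \<alpha> by (simp add: divide_eq_eq mult_ac)
    then have "a + a\<^sup>2 = 2 * Bi * E * (S - (a + a\<^sup>2 / 2))"
      using r pos by simp
    then have "\<bar>(a + a\<^sup>2 / 2) - S\<bar> \<le> (2 + S) / Bi"
      unfolding E_def by (rule convective_deficit_bound[OF a Bi])
    then show ?thesis
      using a s T by blast
  qed
  then obtain a where a: "\<And>Bi. Bi > 0 \<Longrightarrow> a Bi > 0"
    and deficit: "\<And>Bi. Bi > 0 \<Longrightarrow> \<bar>(a Bi + (a Bi)\<^sup>2 / 2) - S\<bar> \<le> (2 + S) / Bi"
    and s: "\<And>Bi t. Bi > 0 \<Longrightarrow> t > 0 \<Longrightarrow> s1 Bi t = s_of (a Bi) t"
    and T: "\<And>Bi t x. Bi > 0 \<Longrightarrow> t > 0 \<Longrightarrow> x \<in> {0..s1 Bi t} \<Longrightarrow>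
              T1 Bi x t = T_of (a Bi) (1 - x / s1 Bi t)"
    by metis
  have ev_pos: "\<forall>\<^sub>F Bi in at_top. Bi > (0::real)"
    by (rule eventually_gt_at_top)
  have "((\<lambda>Bi. (a Bi + (a Bi)\<^sup>2 / 2) - S) \<longlongrightarrow> 0) at_top"
  proof (rule Lim_null_comparison)
    show "\<forall>\<^sub>F Bi in at_top. norm ((a Bi + (a Bi)\<^sup>2 / 2) - S) \<le> (2 + S) / Bi"
      using ev_pos by eventually_elim (use deficit in simp)
    show "((\<lambda>Bi. (2 + S) / Bi) \<longlongrightarrow> 0) at_top"
      by (rule real_tendsto_divide_at_top[OF tendsto_const filterlim_ident])
  qed
  then have "((\<lambda>Bi. a Bi + (a Bi)\<^sup>2 / 2) \<longlongrightarrow> S) at_top"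
    by (rule LIM_zero_cancel)
  then have "((\<lambda>Bi. sqrt (1 + 2 * (a Bi + (a Bi)\<^sup>2 / 2)) - 1) \<longlongrightarrow> sqrt (1 + 2 * S) - 1) at_top"
    by (intro tendsto_intros)
  moreover have "sqrt (1 + 2 * S) - 1 = b"
    using pos_root_quadratic[OF b] bS by simp
  moreover have "\<forall>\<^sub>F Bi in at_top. sqrt (1 + 2 * (a Bi + (a Bi)\<^sup>2 / 2)) - 1 = a Bi"
    using ev_pos by eventually_elim (rule pos_root_quadratic[OF a, symmetric])
  ultimately have lim_a: "(a \<longlongrightarrow> b) at_top"
    by (auto elim: Lim_transform_eventually)
  fix t x :: real
  assume t: "t > 0" and x: "0 < x \<and> x < s1_inf t"
  have "((\<lambda>Bi. s_of (a Bi) t) \<longlongrightarrow> s_of b t) at_top"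
    unfolding s_of_def by (intro tendsto_intros isCont_tendsto_compose[OF isCont_front_coeff_sq] lim_a)
  moreover have "\<forall>\<^sub>F Bi in at_top. s_of (a Bi) t = s1 Bi t"
    using ev_pos by eventually_elim (simp add: s t)
  ultimately have lim_s: "((\<lambda>Bi. s1 Bi t) \<longlongrightarrow> s1_inf t) at_top"
    unfolding s_inf[OF t] by (rule Lim_transform_eventually)
  have "((\<lambda>Bi. T_of (a Bi) (1 - x / s1 Bi t)) \<longlongrightarrow> T_of b (1 - x / s1_inf t)) at_top"
    unfolding T_of_def by (intro tendsto_intros lim_a lim_s) (use x in auto)
  moreover have "\<forall>\<^sub>F Bi in at_top. T_of (a Bi) (1 - x / s1 Bi t) = T1 Bi x t"
    \<comment> \<open>The profile formula holds only up to the front. As \<open>x\<close> lies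
      strictly below the limiting front, it lies below \<open>s1 Bi t\<close> for all large
      \<open>Bi\<close>.\<close>
    using ev_pos order_tendstoD(1)[OF lim_s conjunct2[OF x]]
    by eventually_elim (use T t x in auto)
  moreover have "T_of b (1 - x / s1_inf t) = T1_inf x t"
    using T_inf[OF t] x by simp
  ultimately have "((\<lambda>Bi. T1 Bi x t) \<longlongrightarrow> T1_inf x t) at_top"
    by (auto elim: Lim_transform_eventually)
  then show "((\<lambda>Bi. T1 Bi x t) \<longlongrightarrow> T1_inf x t) at_top \<and> ((\<lambda>Bi. s1 Bi t) \<longlongrightarrow> s1_inf t) at_top"
    using lim_s by blast
qed

end
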